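(* Let $L_1,L_2>0$, $M>\frac{2L_2}{3}+2$, $0\le\rho<1$ and $\Delta\ge0$. There exist constants $C,\theta>0$, depending only on $L_1,L_2,M,\rho,\Delta$, with the following property. Let $f:\mathbb{R}^d\to\mathbb{R}$ satisfy Assumption A with Lipschitz constants $L_1,L_2$, let $x_0\in\mathbb{R}^d$ with $f(x_0)-f^\star=\Delta$, let $0<\epsilon\le1$ and $\epsilon_1=\theta\sqrt{\epsilon}$, and let $\{x_k\}_{k\ge0}$ be any sequence generated by the inexact CRm algorithm with parameters $M,\rho$ started at $x_0$, with inexact Hessians satisfying $\|\mathbf{H}_k-\nabla^2 f(x_k)\|\le\epsilon_1$ for all $k\ge0$. Then for every integer $k$ with $$k\ \ge\ \frac{C}{\epsilon^{3/2}},$$ at least one of the iterates $x_0,\dots,x_k$ is an $\epsilon$-second-order stationary point of $f$.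
   Context: Assumption A on $f:\mathbb{R}^d\to\mathbb{R}$ (with constants $L_1,L_2$): (1) $f$ is twice continuously differentiable and bounded below, $f^\star:=\inf_{x\in\mathbb{R}^d} f(x)>-\infty$; (2) for every $\alpha\in\mathbb{R}$ the sublevel set $\{x: f(x)\le\alpha\}$ is bounded; (3) $\nabla f$ is $L_1$-Lipschitz and $\nabla^2 f$ is $L_2$-Lipschitz (Euclidean norm on vectors, operator norm on matrices). The function $f$ is possibly nonconvex. A point $x$ is an $\epsilon$-second-order stationary point of $f$ if $\|\nabla f(x)\|\le\epsilon$ and $\lambda_{\min}(\nabla^2 f(x))\ge-\sqrt{\epsilon}$, where $\lambda_{\min}$ is the smallest eigenvalue. Inexact CRm (parameters $M,\rho$; initialization $x_0=y_0\in\mathbb{R}^d$). For $k=0,1,2,\dots$, with $\mathbf{H}_k\in\mathbb{R}^{d\times d}$ a symmetric matrix (the inexact Hessian at $x_k$): (Inexact cubic step) $s_{k+1}\in\operatorname{argmin}_{s\in\mathbb{R}^d}\ \nabla f(x_k)^\top s+\frac12 s^\top\mathbf{H}_k s+\frac{M}{6}\|s\|^3$ (a global minimizer), and $y_{k+1}=x_k+s_{k+1}$. (Momentum step) $\beta_{k+1}=\min\{\rho,\ \|\nabla f(y_{k+1})\|,\ \|y_{k+1}-x_k\|\}$ and $v_{k+1}=y_{k+1}+\beta_{k+1}(y_{k+1}-y_k)$. (Monotone step) $x_{k+1}\in\operatorname{argmin}_{x\in\{y_{k+1},v_{k+1}\}} f(x)$. *)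

theory Defs
  imports "HOL-Analysis.Analysis"
begin

text \<open>
  The constants of the theorem must not depend on the dimension, so the dimension has to be
  quantified inside the formula and cannot be a type. All the spaces \<open>\<real>\<^sup>d\<close> are therefore
  realised inside one inner product space, the finitely supported real sequences with
  \<open>x \<bullet> y = (\<Sum>i. x\<^sub>i y\<^sub>i)\<close>: \<open>\<real>\<^sup>d\<close> is the subspace of the sequences supported on \<open>{..<d}\<close>,
  with the inherited Euclidean norm.
\<close>

typedef fvec = "{x :: nat \<Rightarrow> real. finite {i. x i \<noteq> 0}}"
  morphisms coord Abs_fvec
  by (rule exI[of _ "\<lambda>_. 0"]) simp

setup_lifting type_definition_fvec

lemma fvec_eqI: "(\<And>i. coord x i = coord y i) \<Longrightarrow> x = y"
  by (simp add: coord_inject[symmetric] fun_eq_iff)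

lemma finite_coord: "finite {i. coord x i \<noteq> 0}"
  using coord[of x] by simp

instantiation fvec :: real_vector
begin

lift_definition zero_fvec :: fvec is "\<lambda>_. 0" by simp

lift_definition plus_fvec :: "fvec \<Rightarrow> fvec \<Rightarrow> fvec" is "\<lambda>x y i. x i + y i"
proof -
  fix x y :: "nat \<Rightarrow> real"
  assume "finite {i. x i \<noteq> 0}" "finite {i. y i \<noteq> 0}"
  then show "finite {i. x i + y i \<noteq> 0}"
    by (rule finite_subset[OF _ finite_UnI, rotated]) auto
qed

lift_definition minus_fvec :: "fvec \<Rightarrow> fvec \<Rightarrow> fvec" is "\<lambda>x y i. x i - y i"
proof -
  fix x y :: "nat \<Rightarrow> real"
  assume "finite {i. x i \<noteq> 0}" "finite {i. y i \<noteq> 0}"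
  then show "finite {i. x i - y i \<noteq> 0}"
    by (rule finite_subset[OF _ finite_UnI, rotated]) auto
qed

lift_definition uminus_fvec :: "fvec \<Rightarrow> fvec" is "\<lambda>x i. - x i" by simp

lift_definition scaleR_fvec :: "real \<Rightarrow> fvec \<Rightarrow> fvec" is "\<lambda>c x i. c * x i"
  by (erule finite_subset[rotated]) auto

instance
  by standard (transfer; simp add: algebra_simps fun_eq_iff)+

end

lemma coord_simps [simp]:
  "coord 0 i = 0"
  "coord (x + y) i = coord x i + coord y i"
  "coord (x - y) i = coord x i - coord y i"
  "coord (- x) i = - coord x i"
  "coord (c *\<^sub>R x) i = c * coord x i"
  by (transfer; simp)+

instantiation fvec :: real_inner
begin

definition inner_fvec :: "fvec \<Rightarrow> fvec \<Rightarrow> real" where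
  "inner_fvec x y = (\<Sum>i | coord x i \<noteq> 0. coord x i * coord y i)"

definition norm_fvec :: "fvec \<Rightarrow> real" where
  "norm_fvec x = sqrt (inner x x)"

definition sgn_fvec :: "fvec \<Rightarrow> fvec" where
  "sgn_fvec x = inverse (norm x) *\<^sub>R x"

definition dist_fvec :: "fvec \<Rightarrow> fvec \<Rightarrow> real" where
  "dist_fvec x y = norm (x - y)"

definition uniformity_fvec :: "(fvec \<times> fvec) filter" where
  "uniformity_fvec = (INF e\<in>{0<..}. principal {(x, y). dist x y < e})"

definition open_fvec :: "fvec set \<Rightarrow> bool" where
  "open_fvec U \<longleftrightarrow> (\<forall>x\<in>U. \<forall>\<^sub>F (x', y) in uniformity. x' = x \<longrightarrow> y \<in> U)"

lemma inner_fvec_eq_sum: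
  assumes "finite S" "{i. coord x i \<noteq> 0} \<subseteq> S"
  shows "inner x y = (\<Sum>i\<in>S. coord x i * coord y i)"
  unfolding inner_fvec_def by (rule sum.mono_neutral_left) (use assms in auto)

instance
proof
  fix x y z :: fvec and r :: real
  let ?S = "{i. coord x i \<noteq> 0} \<union> {i. coord y i \<noteq> 0}"
  have S: "finite ?S" by (simp add: finite_coord)
  have x: "inner x w = (\<Sum>i\<in>?S. coord x i * coord w i)" for w
    by (rule inner_fvec_eq_sum[OF S]) auto
  have y: "inner y w = (\<Sum>i\<in>?S. coord y i * coord w i)" for w
    by (rule inner_fvec_eq_sum[OF S]) auto
  show "inner x y = inner y x"
    unfolding x[of y] y[of x] by (simp add: mult.commute)
  have "inner (x + y) z = (\<Sum>i\<in>?S. coord (x + y) i * coord z i)"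
    by (rule inner_fvec_eq_sum[OF S]) auto
  then show "inner (x + y) z = inner x z + inner y z"
    unfolding x[of z] y[of z] by (simp add: sum.distrib distrib_right)
  have "inner (r *\<^sub>R x) z = (\<Sum>i\<in>?S. coord (r *\<^sub>R x) i * coord z i)"
    by (rule inner_fvec_eq_sum[OF S]) auto
  then show "inner (r *\<^sub>R x) z = r * inner x z"
    unfolding x[of z] by (simp add: sum_distrib_left mult.assoc)
  show "0 \<le> inner x x"
    by (simp add: inner_fvec_def sum_nonneg)
  show "inner x x = 0 \<longleftrightarrow> x = 0"
  proof
    assume "inner x x = 0"
    then have "\<forall>i\<in>{i. coord x i \<noteq> 0}. coord x i * coord x i = 0"
      by (subst (asm) inner_fvec_def, subst (asm) sum_nonneg_eq_0_iff)
        (auto simp: finite_coord)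
    then show "x = 0" by (intro fvec_eqI) auto
  qed (simp add: inner_fvec_def)
qed (simp_all only: norm_fvec_def sgn_fvec_def dist_fvec_def uniformity_fvec_def open_fvec_def)

end

definition Rd :: "nat \<Rightarrow> fvec set" where
  "Rd d = {x. \<forall>i\<ge>d. coord x i = 0}"

lift_definition unit_fvec :: "nat \<Rightarrow> fvec" is "\<lambda>i j. if j = i then 1 else 0"
  by simp

lift_definition vec_of :: "nat \<Rightarrow> (nat \<Rightarrow> real) \<Rightarrow> fvec" is "\<lambda>d a i. if i < d then a i else 0"
  by (rule finite_subset[of _ "{..<d}" for d]) auto

text \<open>A \<open>d \<times> d\<close> matrix is given by its entries with indices below \<open>d\<close>; other entries are ignored.\<close>

type_synonym matrix = "nat \<Rightarrow> nat \<Rightarrow> real"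

definition symmetric_matrix :: "nat \<Rightarrow> matrix \<Rightarrow> bool" where
  "symmetric_matrix d A \<longleftrightarrow> (\<forall>i<d. \<forall>j<d. A i j = A j i)"

definition mat_vec :: "nat \<Rightarrow> matrix \<Rightarrow> fvec \<Rightarrow> fvec" where
  "mat_vec d A v = vec_of d (\<lambda>i. \<Sum>j<d. A i j * coord v j)"

text \<open>
  \<open>mat_vec d A\<close> is \<open>A\<close> composed with the orthogonal projection onto \<open>\<real>\<^sup>d\<close>, so its \<open>onorm\<close> over
  the whole type is the spectral norm of \<open>A\<close> on \<open>\<real>\<^sup>d\<close>.
\<close>

definition mat_norm :: "nat \<Rightarrow> matrix \<Rightarrow> real" where
  "mat_norm d A = onorm (mat_vec d A)"

definition eigenvalues :: "nat \<Rightarrow> matrix \<Rightarrow> real set" where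
  "eigenvalues d A = {l. \<exists>v\<in>Rd d. v \<noteq> 0 \<and> mat_vec d A v = l *\<^sub>R v}"

text \<open>Used for symmetric \<open>A\<close> and \<open>d \<ge> 1\<close> only, where the spectrum is finite and nonempty.\<close>

definition lambda_min :: "nat \<Rightarrow> matrix \<Rightarrow> real" where
  "lambda_min d A = Min (eigenvalues d A)"

text \<open>Only the values of \<open>f\<close> on \<open>\<real>\<^sup>d\<close> matter below: all derivatives are taken within \<open>\<real>\<^sup>d\<close>.\<close>

definition gradient :: "nat \<Rightarrow> (fvec \<Rightarrow> real) \<Rightarrow> fvec \<Rightarrow> fvec" where
  "gradient d f x = vec_of d (\<lambda>i. deriv (\<lambda>t. f (x + t *\<^sub>R unit_fvec i)) 0)"

definition hessian :: "nat \<Rightarrow> (fvec \<Rightarrow> real) \<Rightarrow> fvec \<Rightarrow> matrix" where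
  "hessian d f x = (\<lambda>i j. deriv (\<lambda>t. coord (gradient d f (x + t *\<^sub>R unit_fvec j)) i) 0)"

definition twice_continuously_differentiable :: "nat \<Rightarrow> (fvec \<Rightarrow> real) \<Rightarrow> bool" where
  "twice_continuously_differentiable d f \<longleftrightarrow>
     (\<forall>x\<in>Rd d. (f has_derivative (\<lambda>h. gradient d f x \<bullet> h)) (at x within Rd d)) \<and>
     (\<forall>x\<in>Rd d. (gradient d f has_derivative mat_vec d (hessian d f x)) (at x within Rd d)) \<and>
     (\<forall>i<d. \<forall>j<d. continuous_on (Rd d) (\<lambda>x. hessian d f x i j))"

definition assumption_A :: "nat \<Rightarrow> (fvec \<Rightarrow> real) \<Rightarrow> real \<Rightarrow> real \<Rightarrow> bool" where
  "assumption_A d f L\<^sub>1 L\<^sub>2 \<longleftrightarrow>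
     twice_continuously_differentiable d f \<and>
     bdd_below (f ` Rd d) \<and>
     (\<forall>\<alpha>. bounded {x \<in> Rd d. f x \<le> \<alpha>}) \<and>
     L\<^sub>1-lipschitz_on (Rd d) (gradient d f) \<and>
     (\<forall>x\<in>Rd d. \<forall>y\<in>Rd d. mat_norm d (hessian d f x - hessian d f y) \<le> L\<^sub>2 * norm (x - y))"

definition second_order_stationary :: "nat \<Rightarrow> (fvec \<Rightarrow> real) \<Rightarrow> real \<Rightarrow> fvec \<Rightarrow> bool" where
  "second_order_stationary d f \<epsilon> x \<longleftrightarrow>
     norm (gradient d f x) \<le> \<epsilon> \<and> lambda_min d (hessian d f x) \<ge> - sqrt \<epsilon>"

definition cubic_model ::
  "nat \<Rightarrow> (fvec \<Rightarrow> real) \<Rightarrow> real \<Rightarrow> matrix \<Rightarrow> fvec \<Rightarrow> fvec \<Rightarrow> real" where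
  "cubic_model d f M H x s =
     gradient d f x \<bullet> s + 1/2 * (s \<bullet> mat_vec d H s) + M/6 * norm s ^ 3"

definition inexact_CRm ::
  "nat \<Rightarrow> (fvec \<Rightarrow> real) \<Rightarrow> real \<Rightarrow> real \<Rightarrow> fvec \<Rightarrow> (nat \<Rightarrow> matrix) \<Rightarrow> (nat \<Rightarrow> fvec) \<Rightarrow> bool" where
  "inexact_CRm d f M \<rho> x\<^sub>0 H x \<longleftrightarrow>
     (\<exists>y s v \<beta>.
        x 0 = x\<^sub>0 \<and> y 0 = x\<^sub>0 \<and>
        (\<forall>k. symmetric_matrix d (H k) \<and>
             is_arg_min (cubic_model d f M (H k) (x k)) (\<lambda>z. z \<in> Rd d) (s (Suc k)) \<and>
             y (Suc k) = x k + s (Suc k) \<and>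
             \<beta> (Suc k) = Min {\<rho>, norm (gradient d f (y (Suc k))), norm (y (Suc k) - x k)} \<and>
             v (Suc k) = y (Suc k) + \<beta> (Suc k) *\<^sub>R (y (Suc k) - y k) \<and>
             is_arg_min f (\<lambda>z. z \<in> {y (Suc k), v (Suc k)}) (x (Suc k))))"

end

theory Submission
  imports Defs
begin

text \<open>
  The argument is a potential argument on the values \<open>f (x k)\<close>. Write \<open>r\<close> for the length of the cubic
  step taken at \<open>x k\<close> and \<open>\<delta> = \<theta> sqrt \<epsilon>\<close> for the error of the inexact Hessian.

  A global minimizer \<open>s\<close> of the cubic model satisfies the stationarity equation
  \<open>g + H s + (M r / 2) s = 0\<close> and the global curvature bound \<open>H + (M r / 2) I \<ge> 0\<close>. Together they
  make the quadratic part of the model at most \<open>- M r^3 / 4\<close>; the Taylor remainder costs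
  \<open>L\<^sub>2 r^3 / 6\<close> and the Hessian error \<open>\<delta> r^2 / 2\<close>, so the condition on \<open>M\<close> leaves a decrease of \<open>f\<close> of at
  least \<open>(r^3 - \<delta>^3) / 6\<close> (lemma \<open>value_decrease\<close>).

  If \<open>r\<close> is at most a small multiple \<open>c sqrt \<epsilon>\<close>, then the same two conditions make
  \<open>y (k+1) = x k + s\<close> second-order stationary. The next iterate may be the
  extrapolated point instead, which lies at distance \<open>\<beta> * norm (y (k+1) - y k)\<close> from \<open>y (k+1)\<close>. As
  \<open>\<beta>\<close> is at most the norm of the gradient at \<open>y (k+1)\<close> and at most \<open>r\<close>, stationarity survives provided
  \<open>norm (y (k+1) - y k)\<close> has an a priori bound \<open>D\<close> (lemma \<open>stationary_near_short_step\<close>). Such a bound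
  independent of \<open>f\<close> exists: the decrease estimate bounds every step by \<open>6 \<Delta> + 1\<close>, and because
  \<open>\<beta> \<le> \<rho> < 1\<close> the momentum accumulates at most a geometric series, which gives
  \<open>D = (6 \<Delta> + 1) / (1 - \<rho>)\<close> (lemma \<open>iteration\<close>).

  Hence, with \<open>\<theta> = c / 2\<close>, as long as no iterate is second-order stationary, every step is longer than
  \<open>c sqrt \<epsilon>\<close> and lowers \<open>f\<close> by at least a constant times \<open>\<epsilon>\<close> to the power \<open>3/2\<close>. The total decrease cannot
  exceed \<open>\<Delta>\<close>, which bounds the number of such steps.

  Since \<open>\<lambda>\<close>-min is the minimum of a set of real eigenvalues, two classical facts enter as
  well: the Hessian is symmetric, and a symmetric matrix has a finite nonempty real spectrum.
\<close>

section \<open>Functions with a Lipschitz Hessian\<close>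

text \<open>
  \<open>V\<close> plays the role of \<open>\<real>\<^sup>d\<close>: all derivatives are taken within it, so that along lines in \<open>V\<close>
  they become ordinary derivatives in one real variable. \<open>G\<close> is the gradient and \<open>A x\<close> the Hessian at
  \<open>x\<close> as an operator.
\<close>

locale lipschitz_hessian =
  fixes V :: "'a::real_inner set" and f :: "'a \<Rightarrow> real" and G :: "'a \<Rightarrow> 'a"
    and A :: "'a \<Rightarrow> 'a \<Rightarrow> 'a" and L :: real
  assumes subspace_V: "subspace V"
    and L_nonneg: "0 \<le> L"
    and has_gradient: "x \<in> V \<Longrightarrow> (f has_derivative (\<lambda>h. G x \<bullet> h)) (at x within V)"
    and has_hessian: "x \<in> V \<Longrightarrow> (G has_derivative A x) (at x within V)"
    and hessian_lipschitz:
      "x \<in> V \<Longrightarrow> y \<in> V \<Longrightarrow> u \<in> V \<Longrightarrow> norm (A x u - A y u) \<le> L * norm (x - y) * norm u"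
begin

lemma line_in_V: "x \<in> V \<Longrightarrow> u \<in> V \<Longrightarrow> x + t *\<^sub>R u \<in> V"
  using subspace_V by (simp add: subspace_add subspace_scale)

lemma linear_hessian: "x \<in> V \<Longrightarrow> linear (A x)"
  using has_hessian has_derivative_linear by blast

lemma value_along_line:
  assumes "x \<in> V" "u \<in> V"
  shows "((\<lambda>t. f (x + t *\<^sub>R u)) has_real_derivative G (x + t *\<^sub>R u) \<bullet> u) (at t)"
proof -
  have "((\<lambda>t. x + t *\<^sub>R u) has_derivative (\<lambda>h. h *\<^sub>R u)) (at t)"
    by (auto intro!: derivative_eq_intros)
  moreover have "(f has_derivative (\<lambda>h. G (x + t *\<^sub>R u) \<bullet> h))
      (at (x + t *\<^sub>R u) within range (\<lambda>t. x + t *\<^sub>R u))"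
    by (rule has_derivative_subset[OF has_gradient]) (use assms line_in_V in auto)
  ultimately have "((\<lambda>t. f (x + t *\<^sub>R u)) has_derivative (\<lambda>h. G (x + t *\<^sub>R u) \<bullet> (h *\<^sub>R u))) (at t)"
    by (rule has_derivative_in_compose)
  then show ?thesis
    by (simp add: has_field_derivative_def mult.commute[of _ "_ \<bullet> _"] fun_eq_iff)
qed

lemma gradient_along_line:
  assumes "x \<in> V" "u \<in> V"
  shows "((\<lambda>t. G (x + t *\<^sub>R u) \<bullet> w) has_real_derivative A (x + t *\<^sub>R u) u \<bullet> w) (at t)"
proof -
  have "((\<lambda>t. x + t *\<^sub>R u) has_derivative (\<lambda>h. h *\<^sub>R u)) (at t)"
    by (auto intro!: derivative_eq_intros)
  moreover have "(G has_derivative A (x + t *\<^sub>R u))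
      (at (x + t *\<^sub>R u) within range (\<lambda>t. x + t *\<^sub>R u))"
    by (rule has_derivative_subset[OF has_hessian]) (use assms line_in_V in auto)
  ultimately have "((\<lambda>t. G (x + t *\<^sub>R u)) has_derivative (\<lambda>h. A (x + t *\<^sub>R u) (h *\<^sub>R u))) (at t)"
    by (rule has_derivative_in_compose)
  then have "((\<lambda>t. G (x + t *\<^sub>R u) \<bullet> w) has_derivative (\<lambda>h. A (x + t *\<^sub>R u) (h *\<^sub>R u) \<bullet> w)) (at t)"
    by (rule has_derivative_inner_left)
  then show ?thesis
    using linear_hessian[OF line_in_V[OF assms]]
    by (simp add: has_field_derivative_def linear_scale mult.commute[of _ "_ \<bullet> _"] fun_eq_iff)
qed

text \<open>
  The difference of the two sides vanishes at \<open>t = 0\<close> and has a nonpositive derivative by the Lipschitz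
  bound on the Hessian.
\<close>

lemma gradient_taylor_inner:
  assumes "x \<in> V" "u \<in> V" "0 \<le> t"
  shows "(G (x + t *\<^sub>R u) - G x - t *\<^sub>R A x u) \<bullet> w \<le> L / 2 * (t * norm u)\<^sup>2 * norm w"
proof -
  define \<phi> where "\<phi> t = G (x + t *\<^sub>R u) \<bullet> w - t * (A x u \<bullet> w) - L / 2 * (t * norm u)\<^sup>2 * norm w" for t
  define \<phi>' where "\<phi>' t = A (x + t *\<^sub>R u) u \<bullet> w - A x u \<bullet> w - L * t * (norm u)\<^sup>2 * norm w" for t
  have deriv: "(\<phi> has_real_derivative \<phi>' t) (at t)" for t
    unfolding \<phi>_def \<phi>'_def
    by (auto intro!: derivative_eq_intros gradient_along_line assms simp: power2_eq_square)
  have nonpos: "\<phi>' \<tau> \<le> 0" if "0 \<le> \<tau>" for \<tau>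
  proof -
    have "(A (x + \<tau> *\<^sub>R u) u - A x u) \<bullet> w \<le> norm (A (x + \<tau> *\<^sub>R u) u - A x u) * norm w"
      by (rule norm_cauchy_schwarz)
    also have "\<dots> \<le> (L * norm (\<tau> *\<^sub>R u) * norm u) * norm w"
      using hessian_lipschitz[OF line_in_V[OF assms(1,2)] assms(1,2), of \<tau>]
      by (intro mult_right_mono) auto
    finally show ?thesis
      using that by (simp add: \<phi>'_def inner_diff_left power2_eq_square algebra_simps)
  qed
  have "\<phi> t \<le> \<phi> 0"
    using deriv nonpos by (intro DERIV_nonpos_imp_nonincreasing[OF \<open>0 \<le> t\<close>]) blast
  then show ?thesis by (simp add: \<phi>_def inner_diff_left)
qed

lemma gradient_taylor:
  assumes "x \<in> V" "u \<in> V"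
  shows "norm (G (x + u) - G x - A x u) \<le> L / 2 * (norm u)\<^sup>2"
proof -
  let ?e = "G (x + u) - G x - A x u"
  have "norm ?e * norm ?e \<le> L / 2 * (norm u)\<^sup>2 * norm ?e"
    using gradient_taylor_inner[OF assms, of 1 ?e] by (simp add: dot_square_norm power2_eq_square)
  moreover have "0 \<le> L / 2 * (norm u)\<^sup>2" using L_nonneg by simp
  ultimately show ?thesis
    using mult_le_cancel_right_pos[of "norm ?e"] by (cases "norm ?e = 0") auto
qed

text \<open>
  The constant \<open>L / 6\<close> is the sharp one, obtained by integrating the gradient estimate once more along
  the segment; a cruder constant would not be compensated by \<open>M \<ge> 2 * L / 3 + 2\<close>.
\<close>

lemma value_taylor:
  assumes "x \<in> V" "u \<in> V"
  shows "f (x + u) \<le> f x + G x \<bullet> u + 1/2 * (u \<bullet> A x u) + L / 6 * norm u ^ 3"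
proof -
  define \<phi> where "\<phi> t = f (x + t *\<^sub>R u) - t * (G x \<bullet> u) - t\<^sup>2 / 2 * (u \<bullet> A x u)
    - L / 6 * (t * norm u) ^ 3" for t
  define \<phi>' where "\<phi>' t = G (x + t *\<^sub>R u) \<bullet> u - G x \<bullet> u - t * (u \<bullet> A x u)
    - L / 2 * (t * norm u)\<^sup>2 * norm u" for t
  have deriv: "(\<phi> has_real_derivative \<phi>' t) (at t)" for t
    unfolding \<phi>_def \<phi>'_def
    by (auto intro!: derivative_eq_intros value_along_line assms
        simp: power2_eq_square power3_eq_cube)
  have nonpos: "\<phi>' \<tau> \<le> 0" if "0 \<le> \<tau>" for \<tau>
    using gradient_taylor_inner[OF assms that, of u]
    by (simp add: \<phi>'_def inner_diff_left inner_commute[of u])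
  have "\<phi> 1 \<le> \<phi> 0"
    using deriv nonpos by (intro DERIV_nonpos_imp_nonincreasing[of 0 1]) (simp, blast)
  then show ?thesis by (simp add: \<phi>_def)
qed

text \<open>
  The expression \<open>f (x + t u + t w) - f (x + t u) - f (x + t w) + f x\<close> is symmetric in \<open>u\<close> and \<open>w\<close>, and it
  determines \<open>A x u \<bullet> w\<close> up to an error of higher order in \<open>t\<close>; this yields Schwarz's theorem below. The
  mean value theorem in the direction \<open>w\<close> reduces it to a difference of two gradients, and each of them
  is replaced by its first-order expansion at \<open>x\<close>.
\<close>

lemma second_difference:
  assumes "x \<in> V" "u \<in> V" "w \<in> V" "0 < t"
  shows "\<bar>f (x + t *\<^sub>R u + t *\<^sub>R w) - f (x + t *\<^sub>R u) - f (x + t *\<^sub>R w) + f x - t\<^sup>2 * (A x u \<bullet> w)\<bar>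
    \<le> L * (norm u + norm w) ^ 3 * t ^ 3"
proof -
  define \<phi> where "\<phi> \<tau> = f (x + t *\<^sub>R u + \<tau> *\<^sub>R w) - f (x + \<tau> *\<^sub>R w)" for \<tau>
  have "(\<phi> has_real_derivative (G (x + t *\<^sub>R u + \<tau> *\<^sub>R w) \<bullet> w - G (x + \<tau> *\<^sub>R w) \<bullet> w)) (at \<tau>)" for \<tau>
    unfolding \<phi>_def by (auto intro!: derivative_eq_intros value_along_line assms line_in_V)
  from MVT2[OF \<open>0 < t\<close> this] obtain \<xi> where \<xi>: "0 < \<xi>" "\<xi> < t"
    and mvt: "\<phi> t - \<phi> 0 = t * (G (x + t *\<^sub>R u + \<xi> *\<^sub>R w) \<bullet> w - G (x + \<xi> *\<^sub>R w) \<bullet> w)"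
    by auto
  define e where "e h = G (x + h) - G x - A x h" for h
  have e: "norm (e h) \<le> L / 2 * (t * (norm u + norm w))\<^sup>2"
    if "h \<in> V" "norm h \<le> t * (norm u + norm w)" for h
  proof -
    have "norm (e h) \<le> L / 2 * (norm h)\<^sup>2"
      unfolding e_def using gradient_taylor assms(1) that(1) by blast
    also have "\<dots> \<le> L / 2 * (t * (norm u + norm w))\<^sup>2"
      using L_nonneg that by (intro mult_left_mono power_mono) auto
    finally show ?thesis .
  qed
  let ?h = "\<xi> *\<^sub>R w" and ?h' = "t *\<^sub>R u + \<xi> *\<^sub>R w"
  have in_V: "?h \<in> V" "?h' \<in> V"
    using subspace_V assms by (auto intro: subspace_add subspace_scale)
  have small: "norm ?h \<le> t * (norm u + norm w)"
  proof -
    have "\<xi> * norm w \<le> t * norm w" "0 \<le> t * norm u"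
      using \<xi> by (auto intro: mult_right_mono)
    then have "\<xi> * norm w \<le> t * (norm u + norm w)" unfolding distrib_left by linarith
    then show ?thesis using \<xi> by simp
  qed
  have small': "norm ?h' \<le> t * (norm u + norm w)"
  proof -
    have "norm ?h' \<le> t * norm u + \<xi> * norm w"
      using norm_triangle_ineq[of "t *\<^sub>R u" ?h] \<xi> by simp
    also have "\<xi> * norm w \<le> t * norm w" using \<xi> by (auto intro: mult_right_mono)
    finally show ?thesis by (simp add: distrib_left)
  qed
  have "A x ?h' - A x ?h = t *\<^sub>R A x u"
    using linear_hessian[OF \<open>x \<in> V\<close>] by (simp add: linear_add linear_scale)
  then have "G (x + t *\<^sub>R u + ?h) \<bullet> w - G (x + ?h) \<bullet> w = t * (A x u \<bullet> w) + (e ?h' - e ?h) \<bullet> w"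
    by (simp add: e_def add.assoc algebra_simps inner_diff_left inner_add_left
        flip: inner_scaleR_left)
  then have "\<phi> t - \<phi> 0 - t\<^sup>2 * (A x u \<bullet> w) = t * ((e ?h' - e ?h) \<bullet> w)"
    unfolding mvt by (simp only: power2_eq_square distrib_left mult.assoc add_diff_cancel_left')
  moreover have "\<bar>(e ?h' - e ?h) \<bullet> w\<bar> \<le> (L * (t * (norm u + norm w))\<^sup>2) * (norm u + norm w)"
  proof -
    have "norm (e ?h' - e ?h) \<le> L * (t * (norm u + norm w))\<^sup>2"
      using e[OF in_V(1) small] e[OF in_V(2) small'] norm_triangle_ineq4[of "e ?h'" "e ?h"] by simp
    then have "norm (e ?h' - e ?h) * norm w
        \<le> (L * (t * (norm u + norm w))\<^sup>2) * (norm u + norm w)"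
      using L_nonneg by (intro mult_mono) auto
    then show ?thesis using Cauchy_Schwarz_ineq2[of "e ?h' - e ?h" w] by linarith
  qed
  ultimately have "\<bar>\<phi> t - \<phi> 0 - t\<^sup>2 * (A x u \<bullet> w)\<bar>
      \<le> t * ((L * (t * (norm u + norm w))\<^sup>2) * (norm u + norm w))"
    using \<open>0 < t\<close> by (simp add: abs_mult)
  also have "\<dots> = L * (norm u + norm w) ^ 3 * t ^ 3"
    by (simp add: power2_eq_square power3_eq_cube)
  finally show ?thesis by (simp add: \<phi>_def algebra_simps)
qed

lemma hessian_symmetric:
  assumes "x \<in> V" "u \<in> V" "w \<in> V"
  shows "A x u \<bullet> w = A x w \<bullet> u"
proof (rule ccontr)
  define K where "K = L * (norm u + norm w) ^ 3"
  define \<delta> where "\<delta> = \<bar>A x u \<bullet> w - A x w \<bullet> u\<bar>"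
  assume "A x u \<bullet> w \<noteq> A x w \<bullet> u"
  then have \<delta>: "0 < \<delta>" by (simp add: \<delta>_def)
  have K: "0 \<le> K" using L_nonneg by (simp add: K_def)
  have bound: "\<delta> \<le> 2 * K * t" if t: "0 < t" for t
  proof -
    have "\<bar>t\<^sup>2 * (A x u \<bullet> w) - t\<^sup>2 * (A x w \<bullet> u)\<bar> \<le> 2 * K * t ^ 3"
      using second_difference[OF assms t] second_difference[OF assms(1,3,2) t]
      unfolding K_def by (simp add: add.commute add.left_commute)
    then have "t\<^sup>2 * \<delta> \<le> t\<^sup>2 * (2 * K * t)"
      by (simp add: \<delta>_def abs_mult flip: right_diff_distrib)
        (simp add: power2_eq_square power3_eq_cube algebra_simps)
    then show ?thesis using t by simp
  qed
  have "2 * K * (\<delta> / (4 * (K + 1))) < \<delta>"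
    using K \<delta> by (simp add: field_simps add_pos_nonneg)
  with bound[of "\<delta> / (4 * (K + 1))"] K \<delta> show False by simp
qed

end

section \<open>Global minimizers of a cubic model\<close>

text \<open>
  First-order conditions are derived from minimality by dividing an inequality for small steps \<open>t\<close> by a
  power of \<open>t\<close> and letting \<open>t\<close> tend to \<open>0\<close>; this is the limit step.
\<close>

lemma quadratic_constant_term_nonneg:
  fixes a b c :: real
  assumes "\<And>t. 0 < t \<Longrightarrow> t \<le> 1 \<Longrightarrow> 0 \<le> a + b * t + c * t\<^sup>2"
  shows "0 \<le> a"
proof (rule tendsto_lowerbound)
  show "((\<lambda>t. a + b * t + c * t\<^sup>2) \<longlongrightarrow> a) (at_right 0)"
    by (auto intro!: tendsto_eq_intros)
  show "\<forall>\<^sub>F t in at_right 0. 0 \<le> a + b * t + c * t\<^sup>2"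
    unfolding eventually_at_right_field using assms by (intro exI[of _ 1]) auto
qed simp

text \<open>
  An expansion of the cubed norm with an explicit remainder, which avoids differentiating it and so
  covers \<open>s = 0\<close> without a case distinction. It rests on the identity
  \<open>R^3 = r^3 + 3/2 r (R^2 - r^2) + (R - r)^2 (R + r / 2)\<close>.
\<close>

lemma norm_cube_add_le:
  fixes s h :: "'a::real_inner"
  shows "norm (s + h) ^ 3 \<le> norm s ^ 3 + 3 * norm s * (s \<bullet> h) + (norm h)\<^sup>2 * (3 * norm s + norm h)"
proof -
  let ?r = "norm s" and ?R = "norm (s + h)"
  have R: "?R\<^sup>2 = ?r\<^sup>2 + 2 * (s \<bullet> h) + (norm h)\<^sup>2"
    by (simp add: power2_norm_eq_inner inner_add_left inner_add_right inner_commute)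
  have "?R ^ 3 = ?r ^ 3 + 3/2 * ?r * (?R\<^sup>2 - ?r\<^sup>2) + (?R - ?r)\<^sup>2 * (?R + ?r / 2)"
    by (simp add: power2_eq_square power3_eq_cube algebra_simps)
  also have "\<dots> = ?r ^ 3 + 3 * ?r * (s \<bullet> h) + 3/2 * ?r * (norm h)\<^sup>2 + (?R - ?r)\<^sup>2 * (?R + ?r / 2)"
    unfolding R by (simp add: algebra_simps)
  also have "(?R - ?r)\<^sup>2 * (?R + ?r / 2) \<le> (norm h)\<^sup>2 * (3/2 * ?r + norm h)"
  proof (intro mult_mono)
    have "\<bar>?R - ?r\<bar> \<le> norm h" using norm_triangle_ineq3[of "s + h" s] by simp
    then show "(?R - ?r)\<^sup>2 \<le> (norm h)\<^sup>2" using abs_le_square_iff by fastforce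
    show "?R + ?r / 2 \<le> 3/2 * ?r + norm h" using norm_triangle_ineq[of s h] by simp
  qed auto
  finally show ?thesis by (simp add: algebra_simps)
qed

locale cubic_minimizer =
  fixes V :: "'a::real_inner set" and g :: 'a and H :: "'a \<Rightarrow> 'a" and M :: real and s :: 'a
  assumes V: "subspace V" and H: "linear H" and H_closed: "w \<in> V \<Longrightarrow> H w \<in> V"
    and H_symmetric: "u \<in> V \<Longrightarrow> w \<in> V \<Longrightarrow> H u \<bullet> w = H w \<bullet> u"
    and g_in_V: "g \<in> V" and M_nonneg: "0 \<le> M" and s_in_V: "s \<in> V"
    and minimal: "z \<in> V \<Longrightarrow> g \<bullet> s + 1/2 * (s \<bullet> H s) + M/6 * norm s ^ 3
      \<le> g \<bullet> z + 1/2 * (z \<bullet> H z) + M/6 * norm z ^ 3"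
begin

lemma minimal_difference:
  assumes "h \<in> V"
  shows "0 \<le> (g + H s) \<bullet> h + 1/2 * (h \<bullet> H h) + M/6 * (norm (s + h) ^ 3 - norm s ^ 3)"
proof -
  have "s + h \<in> V" using V s_in_V assms by (simp add: subspace_add)
  moreover have "(s + h) \<bullet> H (s + h) = s \<bullet> H s + 2 * (H s \<bullet> h) + h \<bullet> H h"
    using H_symmetric[OF s_in_V assms]
    by (simp add: linear_add[OF H] inner_add_left inner_add_right inner_commute)
  ultimately show ?thesis
    using minimal[of "s + h"] by (simp add: inner_add_left inner_add_right algebra_simps)
qed

text \<open>
  The step \<open>- t z\<close>, where \<open>z\<close> is the claimed zero vector, changes the model by
  \<open>- t (z \<bullet> z)\<close> up to second order in \<open>t\<close>, and this change cannot be negative.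
\<close>

lemma stationary: "g + H s + (M / 2 * norm s) *\<^sub>R s = 0"
proof -
  define z where "z = g + H s + (M / 2 * norm s) *\<^sub>R s"
  have z: "z \<in> V"
    unfolding z_def using V g_in_V s_in_V H_closed by (auto intro: subspace_add subspace_scale)
  have gz: "(g + H s) \<bullet> h = z \<bullet> h - M / 2 * norm s * (s \<bullet> h)" for h
    by (simp add: z_def inner_add_left)
  have "0 \<le> - (z \<bullet> z)"
  proof (rule quadratic_constant_term_nonneg)
    fix t :: real
    assume t: "0 < t" "t \<le> 1"
    define h where "h = - t *\<^sub>R z"
    have h: "h \<in> V" unfolding h_def using V z by (intro subspace_scale)
    have norm_h: "norm h = t * norm z" using t by (simp add: h_def)
    have "M/6 * (norm (s + h) ^ 3 - norm s ^ 3)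
        \<le> M/6 * (3 * norm s * (s \<bullet> h) + (norm h)\<^sup>2 * (3 * norm s + norm h))"
      using M_nonneg norm_cube_add_le[of s h] by (intro mult_left_mono) auto
    also have "\<dots> = M/2 * norm s * (s \<bullet> h) + M/6 * (norm h)\<^sup>2 * (3 * norm s + norm h)"
      by (simp add: algebra_simps)
    also have "M/6 * (norm h)\<^sup>2 * (3 * norm s + norm h)
        \<le> M/6 * (t * norm z)\<^sup>2 * (3 * norm s + norm z)"
      unfolding norm_h using M_nonneg t by (intro mult_left_mono) (auto intro: mult_left_le_one_le)
    finally have "0 \<le> z \<bullet> h + 1/2 * (h \<bullet> H h) + M/6 * (t * norm z)\<^sup>2 * (3 * norm s + norm z)"
      using minimal_difference[OF h] unfolding gz by linarith
    also have "\<dots> = t * (- (z \<bullet> z)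
        + (1/2 * (z \<bullet> H z) + M/6 * (norm z)\<^sup>2 * (3 * norm s + norm z)) * t + 0 * t\<^sup>2)"
      by (simp add: h_def linear_scale[OF H] linear_neg[OF H] power2_eq_square algebra_simps)
    finally show "0 \<le> - (z \<bullet> z)
        + (1/2 * (z \<bullet> H z) + M/6 * (norm z)\<^sup>2 * (3 * norm s + norm z)) * t + 0 * t\<^sup>2"
      using t by (simp only: zero_le_mult_iff) linarith
  qed
  then have "z = 0" using inner_gt_zero_iff[of z] by linarith
  then show ?thesis by (simp only: z_def)
qed

text \<open>
  This uses that \<open>s\<close> is a global minimizer: at a local one only \<open>H + (M r / 2) (I + s s\<^sup>T / r\<^sup>2) \<ge> 0\<close> would
  follow. A direction \<open>u\<close> that is not orthogonal to \<open>s\<close> points from \<open>s\<close> to a second point of the same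
  norm, the reflection of \<open>s\<close> in the hyperplane orthogonal to \<open>u\<close>. Between these two points the cubic
  term does not change, and the difference of the model values is exactly a positive multiple of the
  quadratic form at \<open>u\<close>. Orthogonal directions are limits of such directions, unless \<open>s = 0\<close>, where
  the model is dominated by its quadratic part near the origin.
\<close>

lemma curvature:
  assumes "w \<in> V"
  shows "0 \<le> w \<bullet> H w + M / 2 * norm s * (w \<bullet> w)"
proof -
  let ?B = "\<lambda>w. H w + (M / 2 * norm s) *\<^sub>R w"
  have g: "g + H s = - ((M / 2 * norm s) *\<^sub>R s)"
    using stationary by (simp add: add_eq_0_iff2)
  have main: "0 \<le> u \<bullet> ?B u" if u: "u \<in> V" and non_orth: "s \<bullet> u \<noteq> 0" for u
  proof -
    have "u \<noteq> 0" using non_orth by auto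
    then have uu: "0 < u \<bullet> u" by simp
    \<comment> \<open>With this \<open>\<tau>\<close>, the point \<open>s + \<tau> u\<close> is the reflection of \<open>s\<close>.\<close>
    define \<tau> where "\<tau> = - 2 * (s \<bullet> u) / (u \<bullet> u)"
    let ?h = "\<tau> *\<^sub>R u"
    have h: "?h \<in> V" using V u by (simp add: subspace_scale)
    have hs: "2 * (s \<bullet> ?h) = - (?h \<bullet> ?h)" using uu by (simp add: \<tau>_def field_simps)
    have "(norm (s + ?h))\<^sup>2 = (norm s)\<^sup>2"
      using hs by (simp add: power2_norm_eq_inner inner_add_left inner_add_right inner_commute)
    then have "norm (s + ?h) = norm s" by (simp add: power2_eq_iff_nonneg)
    then have "0 \<le> - (M / 2 * norm s) * (s \<bullet> ?h) + 1/2 * (?h \<bullet> H ?h)"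
      using minimal_difference[OF h] unfolding g inner_minus_left inner_scaleR_left by simp
    also have "\<dots> = 1/2 * (?h \<bullet> H ?h) + 1/2 * (M / 2 * norm s) * (?h \<bullet> ?h)"
    proof -
      have "s \<bullet> ?h = - (?h \<bullet> ?h) / 2" using hs by linarith
      then show ?thesis by (simp only:) simp
    qed
    also have "\<dots> = \<tau>\<^sup>2 / 2 * (u \<bullet> ?B u)"
      by (simp add: linear_scale[OF H] power2_eq_square algebra_simps)
    finally show ?thesis
      using non_orth uu by (simp add: zero_le_mult_iff \<tau>_def)
  qed
  consider "s = 0" | "s \<noteq> 0" "s \<bullet> w \<noteq> 0" | "s \<noteq> 0" "s \<bullet> w = 0" by blast
  then have "0 \<le> w \<bullet> ?B w"
  proof cases
    case 1
    have "0 \<le> 1/2 * (w \<bullet> H w)"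
    proof (rule quadratic_constant_term_nonneg)
      fix t :: real
      assume t: "0 < t" "t \<le> 1"
      have "0 \<le> 1/2 * t\<^sup>2 * (w \<bullet> H w) + M/6 * norm w ^ 3 * t ^ 3"
        using minimal_difference[of "t *\<^sub>R w"] g 1 t V assms
        by (simp add: subspace_scale linear_scale[OF H] power2_eq_square power_mult_distrib mult_ac)
      also have "\<dots> = t\<^sup>2 * (1/2 * (w \<bullet> H w) + M/6 * norm w ^ 3 * t + 0 * t\<^sup>2)"
        by (simp add: power2_eq_square power3_eq_cube algebra_simps)
      finally show "0 \<le> 1/2 * (w \<bullet> H w) + M/6 * norm w ^ 3 * t + 0 * t\<^sup>2"
        using t by (simp add: zero_le_mult_iff)
    qed
    then show ?thesis using 1 by simp
  next
    case 2
    then show ?thesis using main assms by blast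
  next
    case 3
    show ?thesis
    proof (rule quadratic_constant_term_nonneg)
      fix t :: real
      assume "0 < t"
      have "w + t *\<^sub>R s \<in> V" using V assms s_in_V by (simp add: subspace_add subspace_scale)
      moreover have "s \<bullet> (w + t *\<^sub>R s) \<noteq> 0" using 3 \<open>0 < t\<close> by (simp add: inner_add_right)
      ultimately have "0 \<le> (w + t *\<^sub>R s) \<bullet> ?B (w + t *\<^sub>R s)" by (rule main)
      also have "\<dots> = w \<bullet> ?B w + 2 * (s \<bullet> ?B w) * t + (s \<bullet> ?B s) * t\<^sup>2"
        using H_symmetric[OF assms s_in_V]
        by (simp add: linear_add[OF H] linear_scale[OF H] inner_add_left inner_add_right
            inner_commute[of _ "H _"] inner_commute[of w s] power2_eq_square field_simps)
      finally show "0 \<le> w \<bullet> ?B w + 2 * (s \<bullet> ?B w) * t + (s \<bullet> ?B s) * t\<^sup>2" .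
    qed
  qed
  then show ?thesis by (simp add: inner_add_right)
qed

text \<open>
  Only the quadratic part of the model is bounded: the cubic term of the model is not part of the Taylor
  estimate for \<open>f\<close>, and leaving it out improves the constant from \<open>M / 12\<close> to \<open>M / 4\<close>.
\<close>

lemma model_decrease: "g \<bullet> s + 1/2 * (s \<bullet> H s) \<le> - (M / 4) * norm s ^ 3"
proof -
  have "(g + H s + (M / 2 * norm s) *\<^sub>R s) \<bullet> s = 0"
    unfolding stationary by simp
  then have "g \<bullet> s = - (s \<bullet> H s) - M / 2 * norm s ^ 3"
    by (simp add: inner_add_left inner_commute[of "H s"] dot_square_norm power2_eq_square
        power3_eq_cube)
  moreover have "0 \<le> s \<bullet> H s + M / 2 * norm s ^ 3"
    using curvature[OF s_in_V] by (simp add: dot_square_norm power2_eq_square power3_eq_cube)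
  ultimately show ?thesis by simp
qed

end

section \<open>Matrices on finitely supported sequences\<close>

lemma coord_vec_of: "coord (vec_of d a) i = (if i < d then a i else 0)"
  by transfer simp

lemma coord_unit: "coord (unit_fvec i) j = (if j = i then 1 else 0)"
  by transfer simp

lemma subspace_Rd: "subspace (Rd d)"
  by (auto simp: subspace_def Rd_def)

lemma vec_of_in_Rd: "vec_of d a \<in> Rd d"
  by (simp add: Rd_def coord_vec_of)

lemma mat_vec_in_Rd: "mat_vec d A v \<in> Rd d"
  by (simp add: mat_vec_def vec_of_in_Rd)

lemma gradient_in_Rd: "gradient d f x \<in> Rd d"
  by (simp add: gradient_def vec_of_in_Rd)

lemma inner_Rd:
  assumes "x \<in> Rd d"
  shows "x \<bullet> y = (\<Sum>i<d. coord x i * coord y i)"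
  by (rule inner_fvec_eq_sum) (use assms not_less in \<open>auto simp: Rd_def\<close>)

lemma sum_coord: "coord (\<Sum>i\<in>I. F i) j = (\<Sum>i\<in>I. coord (F i) j)"
  by (induction I rule: infinite_finite_induct) auto

lemma vec_of_eq_sum: "vec_of d a = (\<Sum>i<d. a i *\<^sub>R unit_fvec i)"
  by (rule fvec_eqI) (simp add: coord_vec_of sum_coord coord_unit if_distrib cong: if_cong)

lemma vec_of_coord: "x \<in> Rd d \<Longrightarrow> vec_of d (coord x) = x"
  by (rule fvec_eqI) (auto simp: coord_vec_of Rd_def)

lemma coord_eq_inner: "coord x i = x \<bullet> unit_fvec i"
  by (subst inner_commute, subst inner_fvec_eq_sum[of "{i}"]) (auto simp: coord_unit)

lemma norm_unit: "norm (unit_fvec i) = 1"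
  by (simp add: norm_fvec_def coord_unit flip: coord_eq_inner)

lemma abs_coord_le_norm: "\<bar>coord x i\<bar> \<le> norm x"
  using Cauchy_Schwarz_ineq2[of x "unit_fvec i"] by (simp add: coord_eq_inner norm_unit)

lemma linear_mat_vec: "linear (mat_vec d A)"
  by (rule linearI; rule fvec_eqI)
    (simp_all add: mat_vec_def coord_vec_of distrib_left sum.distrib sum_distrib_left mult_ac)

lemma bounded_linear_mat_vec: "bounded_linear (mat_vec d A)"
proof -
  have "norm (mat_vec d A v) \<le> norm v * (\<Sum>i<d. \<Sum>j<d. \<bar>A i j\<bar>)" for v
  proof -
    have "norm (mat_vec d A v) \<le> (\<Sum>i<d. norm ((\<Sum>j<d. A i j * coord v j) *\<^sub>R unit_fvec i))"
      unfolding mat_vec_def vec_of_eq_sum by (rule norm_sum)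
    also have "\<dots> = (\<Sum>i<d. \<bar>\<Sum>j<d. A i j * coord v j\<bar>)" by (simp add: norm_unit)
    also have "\<dots> \<le> (\<Sum>i<d. \<Sum>j<d. \<bar>A i j\<bar> * norm v)"
      by (intro sum_mono order_trans[OF sum_abs])
        (auto simp: abs_mult intro!: mult_left_mono abs_coord_le_norm)
    finally show ?thesis by (simp add: sum_distrib_left mult.commute)
  qed
  then show ?thesis
    using linear_mat_vec[of d A] unfolding bounded_linear_def bounded_linear_axioms_def by blast
qed

lemma norm_mat_vec_le: "norm (mat_vec d A v) \<le> mat_norm d A * norm v"
  unfolding mat_norm_def using bounded_linear_mat_vec by (rule onorm)

lemma mat_vec_diff: "mat_vec d (A - B) v = mat_vec d A v - mat_vec d B v"
  by (rule fvec_eqI) (simp add: mat_vec_def coord_vec_of left_diff_distrib sum_subtractf)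

lemma mat_vec_symmetric:
  assumes "symmetric_matrix d A" "u \<in> Rd d" "w \<in> Rd d"
  shows "mat_vec d A u \<bullet> w = mat_vec d A w \<bullet> u"
proof -
  have "mat_vec d A u \<bullet> w = (\<Sum>i<d. \<Sum>j<d. A i j * coord u j * coord w i)"
    by (simp add: inner_Rd[OF mat_vec_in_Rd])
      (simp add: mat_vec_def coord_vec_of sum_distrib_right)
  also have "\<dots> = (\<Sum>j<d. \<Sum>i<d. A i j * coord u j * coord w i)"
    by (rule sum.swap)
  also have "\<dots> = (\<Sum>j<d. \<Sum>i<d. A j i * coord w i * coord u j)"
    by (intro sum.cong refl) (use assms in \<open>auto simp: symmetric_matrix_def\<close>)
  also have "\<dots> = mat_vec d A w \<bullet> u"
    by (simp add: inner_Rd[OF mat_vec_in_Rd])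
      (simp add: mat_vec_def coord_vec_of sum_distrib_right)
  finally show ?thesis .
qed

section \<open>The smallest eigenvalue\<close>

text \<open>
  The type \<open>fvec\<close> is infinite-dimensional, so closed bounded sets need not be compact in it. The sphere
  of \<open>\<real>\<^sup>d\<close> is a closed part of a continuous image of a cube, which is compact by Tychonoff's theorem.
\<close>

lemma compact_sphere_Rd: "compact {x \<in> Rd d. norm x = 1}"
proof -
  have "compact (PiE UNIV (\<lambda>_::nat. {-1..1::real}))"
    using compactin_PiE[of "\<lambda>_. euclideanreal" UNIV "\<lambda>_::nat. {-1..1::real}"]
    by (simp add: euclidean_product_topology)
  moreover have "continuous_on (PiE UNIV (\<lambda>_. {-1..1})) (vec_of d)"
    unfolding vec_of_eq_sum[abs_def]
    by (intro continuous_intros continuous_on_subset[OF continuous_on_product_coordinates]) auto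
  ultimately have cube: "compact (vec_of d ` PiE UNIV (\<lambda>_. {-1..1}))"
    by (rule compact_continuous_image[rotated])
  have "{x \<in> Rd d. norm x = 1} = vec_of d ` PiE UNIV (\<lambda>_. {-1..1}) \<inter> {x. norm x = 1}"
  proof (intro equalityI subsetI)
    fix x assume x: "x \<in> {x \<in> Rd d. norm x = 1}"
    then have "\<bar>coord x i\<bar> \<le> 1" for i using abs_coord_le_norm[of x i] by simp
    then have "coord x \<in> PiE UNIV (\<lambda>_. {-1..1})" by (simp add: abs_le_iff PiE_UNIV_domain)
    then show "x \<in> vec_of d ` PiE UNIV (\<lambda>_. {-1..1}) \<inter> {x. norm x = 1}"
      using x vec_of_coord[of x d] by (metis (mono_tags, lifting) IntI image_eqI mem_Collect_eq)
  qed (auto simp: vec_of_in_Rd)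
  moreover have "closed {x::fvec. norm x = 1}"
    by (intro closed_Collect_eq continuous_intros)
  ultimately show ?thesis using cube by (simp add: compact_Int_closed)
qed

text \<open>
  Eigenvectors for different eigenvalues are orthogonal, hence independent, and they all lie in the span
  of \<open>d\<close> unit vectors.
\<close>

lemma finite_eigenvalues:
  assumes sym: "symmetric_matrix d A"
  shows "finite (eigenvalues d A)"
proof -
  define v where "v l = (SOME v. v \<in> Rd d \<and> v \<noteq> 0 \<and> mat_vec d A v = l *\<^sub>R v)" for l
  have v: "v l \<in> Rd d" "v l \<noteq> 0" "mat_vec d A (v l) = l *\<^sub>R v l" if "l \<in> eigenvalues d A" for l
  proof -
    have "\<exists>v. v \<in> Rd d \<and> v \<noteq> 0 \<and> mat_vec d A v = l *\<^sub>R v"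
      using that by (auto simp: eigenvalues_def)
    from someI_ex[OF this]
    show "v l \<in> Rd d" "v l \<noteq> 0" "mat_vec d A (v l) = l *\<^sub>R v l" by (auto simp: v_def)
  qed
  have orth: "v l \<bullet> v m = 0" if "l \<in> eigenvalues d A" "m \<in> eigenvalues d A" "l \<noteq> m" for l m
    using mat_vec_symmetric[OF sym v(1)[OF that(1)] v(1)[OF that(2)]] v(3)[OF that(1)]
      v(3)[OF that(2)] that(3) by (simp add: inner_commute)
  have inj: "inj_on v (eigenvalues d A)"
    by (rule inj_onI) (metis orth v(2) inner_eq_zero_iff)
  have "pairwise orthogonal (v ` eigenvalues d A)"
    unfolding pairwise_def orthogonal_def using orth by blast
  moreover have "0 \<notin> v ` eigenvalues d A" using v(2) by force
  ultimately have "independent (v ` eigenvalues d A)" by (rule pairwise_orthogonal_independent)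
  moreover have "v ` eigenvalues d A \<subseteq> span (unit_fvec ` {..<d})"
  proof clarify
    fix l assume "l \<in> eigenvalues d A"
    then have "v l = (\<Sum>i<d. coord (v l) i *\<^sub>R unit_fvec i)"
      using vec_of_coord[OF v(1)] vec_of_eq_sum by metis
    also have "\<dots> \<in> span (unit_fvec ` {..<d})"
      by (intro span_sum span_scale span_base) auto
    finally show "v l \<in> span (unit_fvec ` {..<d})" .
  qed
  ultimately have "finite (v ` eigenvalues d A)"
    by (meson independent_span_bound finite_imageI finite_lessThan)
  then show ?thesis using inj by (rule finite_imageD)
qed

text \<open>
  The minimum \<open>l\<close> of the Rayleigh quotient over the unit sphere is an eigenvalue. If it is attained at \<open>v\<close>,
  then \<open>A - l\<close> is positive semidefinite and its form vanishes at \<open>v\<close>; moving from \<open>v\<close> against the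
  residual \<open>A v - l v\<close> would make the form negative unless the residual is zero.
\<close>

lemma eigenvalues_nonempty:
  assumes sym: "symmetric_matrix d A" and "d \<ge> 1"
  shows "eigenvalues d A \<noteq> {}"
proof -
  let ?S = "{x \<in> Rd d. norm x = 1}" and ?q = "\<lambda>x. x \<bullet> mat_vec d A x"
  have "unit_fvec 0 \<in> ?S" using \<open>d \<ge> 1\<close> by (auto simp: Rd_def coord_unit norm_unit)
  moreover have "continuous_on ?S ?q"
    by (intro continuous_intros bounded_linear.continuous_on[OF bounded_linear_mat_vec])
  ultimately obtain v where v: "v \<in> Rd d" "norm v = 1" and min: "\<And>x. x \<in> ?S \<Longrightarrow> ?q v \<le> ?q x"
    using continuous_attains_inf[OF compact_sphere_Rd, of d ?q] by blast
  define l where "l = ?q v"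
  have rayleigh: "l * (x \<bullet> x) \<le> ?q x" if "x \<in> Rd d" for x
  proof (cases "x = 0")
    case False
    have "l \<le> ?q ((1 / norm x) *\<^sub>R x)"
      unfolding l_def by (rule min) (use that False subspace_Rd in \<open>auto intro: subspace_scale\<close>)
    also have "\<dots> = ?q x / (x \<bullet> x)"
      by (simp add: linear_scale[OF linear_mat_vec] dot_square_norm power2_eq_square)
    finally show ?thesis using False by (simp add: pos_le_divide_eq)
  qed (simp add: linear_0[OF linear_mat_vec])
  define r where "r = mat_vec d A v - l *\<^sub>R v"
  have r: "r \<in> Rd d"
    unfolding r_def using subspace_Rd v by (auto intro: subspace_diff subspace_scale mat_vec_in_Rd)
  have vr: "v \<bullet> mat_vec d A r = r \<bullet> mat_vec d A v"
    using mat_vec_symmetric[OF sym r v(1)] by (simp add: inner_commute)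
  have "0 \<le> - 2 * (r \<bullet> r)"
  proof (rule quadratic_constant_term_nonneg)
    fix t :: real
    assume "0 < t"
    let ?x = "v - t *\<^sub>R r"
    have "?x \<in> Rd d" using subspace_Rd v r by (auto intro: subspace_diff subspace_scale)
    from rayleigh[OF this] have "0 \<le> ?q ?x - l * (?x \<bullet> ?x)" by simp
    also have "\<dots> = (?q v - l * (v \<bullet> v)) - 2 * t * (r \<bullet> (mat_vec d A v - l *\<^sub>R v))
        + t\<^sup>2 * (?q r - l * (r \<bullet> r))"
      using vr by (simp add: linear_diff[OF linear_mat_vec] linear_scale[OF linear_mat_vec]
          inner_diff_left inner_diff_right inner_commute[of r v] power2_eq_square algebra_simps)
    also have "\<dots> = t * (- 2 * (r \<bullet> r) + (?q r - l * (r \<bullet> r)) * t + 0 * t\<^sup>2)"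
    proof -
      have "?q v - l * (v \<bullet> v) = 0" using v(2) by (simp add: l_def dot_square_norm)
      then show ?thesis unfolding r_def[symmetric] by (simp add: power2_eq_square algebra_simps)
    qed
    finally show "0 \<le> - 2 * (r \<bullet> r) + (?q r - l * (r \<bullet> r)) * t + 0 * t\<^sup>2"
      using \<open>0 < t\<close> by (simp only: zero_le_mult_iff) linarith
  qed
  then have "r = 0" using inner_gt_zero_iff[of r] by linarith
  then have "mat_vec d A v = l *\<^sub>R v" by (simp only: r_def right_minus_eq)
  moreover have "v \<noteq> 0" using v(2) by auto
  ultimately have "l \<in> eigenvalues d A" using v(1) unfolding eigenvalues_def by blast
  then show ?thesis by blast
qed

lemma lambda_min_ge:
  assumes "symmetric_matrix d A" "d \<ge> 1"
    and "\<And>v. v \<in> Rd d \<Longrightarrow> - a * (v \<bullet> v) \<le> v \<bullet> mat_vec d A v"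
  shows "- a \<le> lambda_min d A"
  unfolding lambda_min_def
proof (rule Min.boundedI)
  fix l assume "l \<in> eigenvalues d A"
  then obtain v where "v \<in> Rd d" "v \<noteq> 0" "mat_vec d A v = l *\<^sub>R v"
    by (auto simp: eigenvalues_def)
  then have "- a * (v \<bullet> v) \<le> l * (v \<bullet> v)"
    using assms(3)[of v] by (simp only: inner_scaleR_right)
  moreover have "0 < v \<bullet> v" using \<open>v \<noteq> 0\<close> by simp
  ultimately show "- a \<le> l" by (rule mult_right_le_imp_le)
qed (simp_all add: finite_eigenvalues[OF assms(1)] eigenvalues_nonempty[OF assms(1,2)])

section \<open>One inexact cubic step\<close>

locale inexact_cubic_step =
  lipschitz_hessian V f G A L + cubic_minimizer V "G x" H M s
  for V :: "'a::real_inner set" and f G A L x H M s +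
  fixes \<delta> :: real
  assumes x_in_V: "x \<in> V" and \<delta>_nonneg: "0 \<le> \<delta>"
    and inexact: "w \<in> V \<Longrightarrow> norm (H w - A x w) \<le> \<delta> * norm w"
begin

lemma abs_inexact_quadratic_form:
  assumes "w \<in> V"
  shows "\<bar>w \<bullet> H w - w \<bullet> A x w\<bar> \<le> \<delta> * (w \<bullet> w)"
proof -
  have "\<bar>w \<bullet> (H w - A x w)\<bar> \<le> norm w * norm (H w - A x w)" by (rule Cauchy_Schwarz_ineq2)
  also have "\<dots> \<le> norm w * (\<delta> * norm w)" using inexact[OF assms] by (intro mult_left_mono) auto
  finally show ?thesis by (simp add: inner_diff_right dot_square_norm power2_eq_square mult_ac)
qed

text \<open>
  Under the hypothesis \<open>L / 6 - M / 4 \<le> - 1/2\<close>, so a decrease of \<open>r^3 / 2\<close> has to absorb the Hessian error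
  \<open>\<delta> r^2 / 2\<close>, which by Young's inequality is at most \<open>r^3 / 3 + \<delta>^3 / 6\<close>.
\<close>

lemma value_decrease:
  assumes "2 * L / 3 + 2 \<le> M"
  shows "f (x + s) \<le> f x - (norm s ^ 3 - \<delta> ^ 3) / 6"
proof -
  let ?r = "norm s"
  have "s \<bullet> A x s \<le> s \<bullet> H s + \<delta> * ?r\<^sup>2"
    using abs_inexact_quadratic_form[OF s_in_V] by (simp add: dot_square_norm abs_le_iff)
  moreover have "(L / 6 - M / 4) * ?r ^ 3 \<le> - (1/2) * ?r ^ 3"
    using assms by (intro mult_right_mono) auto
  then have "L / 6 * ?r ^ 3 - M / 4 * ?r ^ 3 \<le> - (?r ^ 3 / 2)"
    by (simp add: left_diff_distrib)
  \<comment> \<open>Young's inequality for the exponents \<open>3/2\<close> and \<open>3\<close>, as the factorization of a cubic polynomial.\<close>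
  moreover have "0 \<le> (?r - \<delta>)\<^sup>2 * (2 * ?r + \<delta>)" using \<delta>_nonneg by simp
  then have "3 * (\<delta> * ?r\<^sup>2) \<le> 2 * ?r ^ 3 + \<delta> ^ 3"
    by (simp add: power2_eq_square power3_eq_cube algebra_simps)
  ultimately show ?thesis
    using value_taylor[OF x_in_V s_in_V] model_decrease by (simp add: diff_divide_distrib)
qed

text \<open>
  By stationarity \<open>G x + H s = - (M r / 2) s\<close>, so the gradient at \<open>x + s\<close> consists of this vector, the
  Taylor remainder and the Hessian error.
\<close>

lemma gradient_after_step: "norm (G (x + s)) \<le> (L + M) / 2 * (norm s)\<^sup>2 + \<delta> * norm s"
proof -
  let ?e = "G (x + s) - G x - A x s"
  have "G (x + s) = ?e - (H s - A x s) - (M / 2 * norm s) *\<^sub>R s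
      + (G x + H s + (M / 2 * norm s) *\<^sub>R s)"
    by simp
  then have "G (x + s) = ?e - (H s - A x s) - (M / 2 * norm s) *\<^sub>R s"
    unfolding stationary by simp
  then have "norm (G (x + s)) \<le> norm ?e + norm (H s - A x s) + norm ((M / 2 * norm s) *\<^sub>R s)"
    by (metis norm_triangle_ineq4 norm_triangle_le_diff add_right_mono)
  moreover have "norm ((M / 2 * norm s) *\<^sub>R s) = M / 2 * (norm s)\<^sup>2"
    using M_nonneg by (simp add: power2_eq_square)
  ultimately show ?thesis
    using gradient_taylor[OF x_in_V s_in_V] inexact[OF s_in_V]
    by (simp add: add_divide_distrib distrib_right)
qed

text \<open>
  The curvature bound for \<open>H\<close> passes to the Hessian at \<open>x\<close> at the cost \<open>\<delta>\<close>, and from there to a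
  nearby point \<open>z\<close> by the Lipschitz condition.
\<close>

lemma curvature_near_step:
  assumes "z \<in> V" "w \<in> V"
  shows "- (M / 2 * norm s + \<delta> + L * norm (z - x)) * (w \<bullet> w) \<le> w \<bullet> A z w"
proof -
  have "\<bar>w \<bullet> (A z w - A x w)\<bar> \<le> norm w * norm (A z w - A x w)" by (rule Cauchy_Schwarz_ineq2)
  also have "\<dots> \<le> norm w * (L * norm (z - x) * norm w)"
    using hessian_lipschitz[OF assms(1) x_in_V assms(2)] by (intro mult_left_mono) auto
  finally have "w \<bullet> A x w - w \<bullet> A z w \<le> L * norm (z - x) * (w \<bullet> w)"
    by (simp add: inner_diff_right dot_square_norm power2_eq_square abs_le_iff mult_ac)
  moreover have "w \<bullet> H w - w \<bullet> A x w \<le> \<delta> * (w \<bullet> w)"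
    using abs_inexact_quadratic_form[OF assms(2)] by linarith
  ultimately show ?thesis using curvature[OF assms(2)] by (simp add: algebra_simps)
qed

text \<open>
  Here \<open>e\<close> stands for \<open>sqrt \<epsilon>\<close> and \<open>z\<close> for the next iterate. Its distance from \<open>x + s\<close> is controlled in two
  ways, one for each half of the conclusion. A perturbation proportional to the gradient at \<open>x + s\<close>
  changes the gradient only by a bounded factor, so it stays of order \<open>e\<^sup>2\<close>; a perturbation
  proportional to \<open>r\<close> changes the Hessian only by order \<open>e\<close>. The conditions on \<open>c\<close> say that the
  resulting constant factors are at most \<open>1\<close>.
\<close>

lemma stationary_near_short_step:
  assumes z: "z \<in> V" "norm (z - (x + s)) \<le> D * norm (G (x + s))" "norm (z - (x + s)) \<le> D * norm s"
    and lipschitz: "L\<^sub>1-lipschitz_on V G"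
    and "0 \<le> D" "0 \<le> c" "c \<le> 1" "0 \<le> e"
    and c1: "(1 + L\<^sub>1 * D) * ((L + M) / 2 + 1) * c \<le> 1"
    and c2: "(M / 2 + 1 + L * (1 + D)) * c \<le> 1"
    and short: "norm s \<le> c * e" and "\<delta> \<le> c * e"
  shows "norm (G z) \<le> e\<^sup>2" and "\<And>w. w \<in> V \<Longrightarrow> - e * (w \<bullet> w) \<le> w \<bullet> A z w"
proof -
  have L1: "0 \<le> L\<^sub>1" using lipschitz by (rule lipschitz_on_nonneg)
  let ?y = "x + s"
  have y: "?y \<in> V" using x_in_V s_in_V subspace_V by (simp add: subspace_add)
  have ce: "0 \<le> c * e" using assms by simp
  have "norm (G z) \<le> norm (G z - G ?y) + norm (G ?y)"
    using norm_triangle_ineq[of "G z - G ?y" "G ?y"] by simp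
  also have "norm (G z - G ?y) \<le> L\<^sub>1 * norm (z - ?y)"
    using lipschitz_onD[OF lipschitz z(1) y] by (simp add: dist_norm)
  also have "\<dots> \<le> L\<^sub>1 * (D * norm (G ?y))" using z(2) L1 by (intro mult_left_mono) auto
  finally have "norm (G z) \<le> (1 + L\<^sub>1 * D) * norm (G ?y)" by (simp add: algebra_simps)
  also have "\<dots> \<le> (1 + L\<^sub>1 * D) * (((L + M) / 2 + 1) * (c * e)\<^sup>2)"
  proof (intro mult_left_mono)
    have "norm (G ?y) \<le> (L + M) / 2 * (norm s)\<^sup>2 + \<delta> * norm s" by (rule gradient_after_step)
    also have "\<dots> \<le> (L + M) / 2 * (c * e)\<^sup>2 + (c * e) * (c * e)"
      using L_nonneg M_nonneg \<delta>_nonneg short \<open>\<delta> \<le> c * e\<close> ce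
      by (intro add_mono mult_left_mono mult_mono power_mono) auto
    finally show "norm (G ?y) \<le> ((L + M) / 2 + 1) * (c * e)\<^sup>2"
      by (simp add: power2_eq_square algebra_simps)
  qed (use L1 \<open>0 \<le> D\<close> in auto)
  also have "\<dots> = ((1 + L\<^sub>1 * D) * ((L + M) / 2 + 1) * c) * (c * e\<^sup>2)"
    by (simp add: power2_eq_square algebra_simps)
  also have "\<dots> \<le> 1 * (1 * e\<^sup>2)"
    using c1 assms(6,7) by (intro mult_mono mult_right_mono) auto
  finally show "norm (G z) \<le> e\<^sup>2" by simp
  have "norm (z - x) \<le> norm (z - ?y) + norm s"
    using norm_triangle_ineq[of "z - ?y" s] by simp
  then have zx: "norm (z - x) \<le> (1 + D) * norm s" using z(3) by (simp add: algebra_simps)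
  have "M / 2 * norm s + \<delta> + L * norm (z - x)
      \<le> M / 2 * (c * e) + c * e + L * ((1 + D) * (c * e))"
    using M_nonneg L_nonneg short \<open>\<delta> \<le> c * e\<close> \<open>0 \<le> D\<close>
    by (intro add_mono mult_left_mono order_trans[OF zx]) auto
  also have "\<dots> = (M / 2 + 1 + L * (1 + D)) * c * e" by (simp add: algebra_simps)
  also have "\<dots> \<le> 1 * e" using c2 \<open>0 \<le> e\<close> by (rule mult_right_mono)
  finally have "- e \<le> - (M / 2 * norm s + \<delta> + L * norm (z - x))" by simp
  then show "- e * (w \<bullet> w) \<le> w \<bullet> A z w" if "w \<in> V" for w
    using curvature_near_step[OF z(1) that] mult_right_mono[of "- e" _ "w \<bullet> w"] inner_ge_zero[of w]
    by (meson order_trans)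
qed

end

section \<open>Runs of the algorithm\<close>

lemma lipschitz_hessian_if_assumption_A:
  assumes "assumption_A d f L\<^sub>1 L\<^sub>2" and "0 \<le> L\<^sub>2"
  shows "lipschitz_hessian (Rd d) f (gradient d f) (\<lambda>x. mat_vec d (hessian d f x)) L\<^sub>2"
proof
  fix x y u assume xy: "x \<in> Rd d" "y \<in> Rd d"
  have "norm (mat_vec d (hessian d f x - hessian d f y) u)
      \<le> mat_norm d (hessian d f x - hessian d f y) * norm u"
    by (rule norm_mat_vec_le)
  also have "\<dots> \<le> L\<^sub>2 * norm (x - y) * norm u"
    using assms xy by (intro mult_right_mono) (auto simp: assumption_A_def)
  finally show "norm (mat_vec d (hessian d f x) u - mat_vec d (hessian d f y) u)
      \<le> L\<^sub>2 * norm (x - y) * norm u"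
    by (simp add: mat_vec_diff)
qed (use assms subspace_Rd in \<open>auto simp: assumption_A_def twice_continuously_differentiable_def\<close>)

text \<open>
  Schwarz's theorem at the level of matrix entries: these are the values of the Hessian form at pairs
  of unit vectors.
\<close>

lemma symmetric_hessian:
  assumes "assumption_A d f L\<^sub>1 L\<^sub>2" and "0 \<le> L\<^sub>2" and "x \<in> Rd d"
  shows "symmetric_matrix d (hessian d f x)"
  unfolding symmetric_matrix_def
proof (intro allI impI)
  interpret lipschitz_hessian "Rd d" f "gradient d f" "\<lambda>x. mat_vec d (hessian d f x)" L\<^sub>2
    using assms by (intro lipschitz_hessian_if_assumption_A)
  fix i j assume ij: "i < d" "j < d"
  have entry: "hessian d f x k l = mat_vec d (hessian d f x) (unit_fvec l) \<bullet> unit_fvec k"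
    if "k < d" "l < d" for k l
    using that by (simp add: mat_vec_def coord_vec_of coord_unit if_distrib flip: coord_eq_inner
        cong: if_cong)
  have "unit_fvec i \<in> Rd d" "unit_fvec j \<in> Rd d" using ij by (auto simp: Rd_def coord_unit)
  then show "hessian d f x i j = hessian d f x j i"
    using hessian_symmetric[OF assms(3), of "unit_fvec j" "unit_fvec i"] ij by (simp add: entry)
qed

text \<open>
  The constants of the proof: \<open>c\<close> is the threshold ratio of step length to \<open>sqrt \<epsilon>\<close> that separates short
  steps from long ones. \<open>D\<close> is the fixed point of \<open>D = (6 * \<Delta> + 1) + \<rho> * D\<close>, so it bounds
  \<open>norm (y (k+1) - y k)\<close> when steps are at most \<open>6 * \<Delta> + 1\<close> long and the momentum contributes at most \<open>\<rho> * D\<close>.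
\<close>

locale CRm_constants =
  fixes d :: nat and f :: "fvec \<Rightarrow> real" and L\<^sub>1 L\<^sub>2 M \<rho> \<Delta> D c \<epsilon> :: real
  assumes d: "1 \<le> d" and assm_A: "assumption_A d f L\<^sub>1 L\<^sub>2" and L2: "0 \<le> L\<^sub>2"
    and M: "2 * L\<^sub>2 / 3 + 2 \<le> M" and \<rho>: "0 \<le> \<rho>" "\<rho> < 1" and \<Delta>: "0 \<le> \<Delta>"
    and D: "(1 - \<rho>) * D = 6 * \<Delta> + 1"
    and c: "0 < c" "c \<le> 1" "(1 + L\<^sub>1 * D) * ((L\<^sub>2 + M) / 2 + 1) * c \<le> 1"
      "(M / 2 + 1 + L\<^sub>2 * (1 + D)) * c \<le> 1"
    and \<epsilon>: "0 < \<epsilon>" "\<epsilon> \<le> 1"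
begin

lemma D_nonneg: "0 \<le> D"
  using D \<rho> \<Delta> zero_le_mult_iff[of "1 - \<rho>" D] by linarith

text \<open>
  The bounds \<open>norm (x - y) \<le> \<rho> * D\<close> and \<open>f x - f\<^sup>\<star> \<le> \<Delta>\<close> are the induction invariant. Together they
  reproduce the first one at the next iterate, and the second one unless that iterate is stationary. The error
  \<open>\<delta> = (c / 2) sqrt \<epsilon>\<close> costs a long step at most one eighth of its decrease, so \<open>(1 - 1/8) / 6 = 7/48\<close>
  of \<open>(c sqrt \<epsilon>)^3\<close> remains.
\<close>

lemma iteration:
  assumes x: "x \<in> Rd d" and y: "y \<in> Rd d" and momentum: "norm (x - y) \<le> \<rho> * D"
    and gap: "f x - (INF z\<in>Rd d. f z) \<le> \<Delta>"
    and H: "symmetric_matrix d H" "mat_norm d (H - hessian d f x) \<le> c / 2 * sqrt \<epsilon>"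
    and s: "is_arg_min (cubic_model d f M H x) (\<lambda>z. z \<in> Rd d) s"
    and y': "y' = x + s"
    and \<beta>: "\<beta> = Min {\<rho>, norm (gradient d f y'), norm (y' - x)}"
    and v: "v = y' + \<beta> *\<^sub>R (y' - y)"
    and x': "is_arg_min f (\<lambda>z. z \<in> {y', v}) x'"
  shows "x' \<in> Rd d" and "y' \<in> Rd d" and "norm (x' - y') \<le> \<rho> * D"
    and "second_order_stationary d f \<epsilon> x' \<or> f x' \<le> f x - 7 * c ^ 3 / 48 * sqrt \<epsilon> ^ 3"
proof -
  let ?e = "sqrt \<epsilon>"
  define \<delta> where "\<delta> = c / 2 * ?e"
  have e: "0 < ?e" "?e \<le> 1" using \<epsilon> by auto
  have ce: "0 < c * ?e" "c * ?e \<le> 1" using c e by (auto intro: mult_le_one)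
  have \<delta>: "0 \<le> \<delta>" "\<delta> \<le> c * ?e" "\<delta> \<le> 1" using ce by (auto simp: \<delta>_def)
  interpret lipschitz_hessian "Rd d" f "gradient d f" "\<lambda>x. mat_vec d (hessian d f x)" L\<^sub>2
    using assm_A L2 by (rule lipschitz_hessian_if_assumption_A)
  interpret inexact_cubic_step "Rd d" f "gradient d f" "\<lambda>x. mat_vec d (hessian d f x)" L\<^sub>2 x
    "mat_vec d H" M s \<delta>
  proof (intro inexact_cubic_step.intro cubic_minimizer.intro inexact_cubic_step_axioms.intro
      lipschitz_hessian_axioms)
    show "linear (mat_vec d H)" by (rule linear_mat_vec)
    show "mat_vec d H u \<bullet> w = mat_vec d H w \<bullet> u" if "u \<in> Rd d" "w \<in> Rd d" for u w
      using mat_vec_symmetric[OF H(1) that] .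
    show "0 \<le> M" using M L2 by linarith
    show "s \<in> Rd d" using s by (simp add: is_arg_min_def)
    show "gradient d f x \<bullet> s + 1/2 * (s \<bullet> mat_vec d H s) + M/6 * norm s ^ 3
      \<le> gradient d f x \<bullet> z + 1/2 * (z \<bullet> mat_vec d H z) + M/6 * norm z ^ 3" if "z \<in> Rd d" for z
      using s that by (auto simp: is_arg_min_def cubic_model_def not_less)
    show "norm (mat_vec d H w - mat_vec d (hessian d f x) w) \<le> \<delta> * norm w" for w
    proof -
      have "norm (mat_vec d (H - hessian d f x) w) \<le> mat_norm d (H - hessian d f x) * norm w"
        by (rule norm_mat_vec_le)
      also have "\<dots> \<le> \<delta> * norm w" using H(2) by (intro mult_right_mono) (auto simp: \<delta>_def)
      finally show ?thesis by (simp add: mat_vec_diff)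
    qed
  qed (use subspace_Rd x \<delta> in \<open>auto intro: mat_vec_in_Rd gradient_in_Rd\<close>)
  show y'_in: "y' \<in> Rd d" unfolding y' using subspace_Rd x s_in_V by (rule subspace_add)
  then have v_in: "v \<in> Rd d"
    unfolding v using subspace_Rd y by (auto intro: subspace_add subspace_scale subspace_diff)
  have x'_cases: "x' = y' \<or> x' = v" and fx': "f x' \<le> f y'"
    using x' by (auto simp: is_arg_min_def not_less)
  then show x'_in: "x' \<in> Rd d" using y'_in v_in by auto
  have decrease: "f y' \<le> f x - (norm s ^ 3 - \<delta> ^ 3) / 6"
    unfolding y' using M by (rule value_decrease)
  have "(INF z\<in>Rd d. f z) \<le> f y'"
    using assm_A y'_in by (intro cINF_lower) (auto simp: assumption_A_def)
  moreover have "\<delta> ^ 3 \<le> 1" using \<delta> by (intro power_le_one)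
  moreover have "norm s ^ 3 - \<delta> ^ 3 \<le> 6 * (f x - f y')" using decrease by (simp add: field_simps)
  moreover have "6 * (f x - f y') \<le> 6 * \<Delta>" using calculation(1) gap by simp
  ultimately have "norm s ^ 3 \<le> 6 * \<Delta> + 1" by linarith
  also have "\<dots> \<le> (6 * \<Delta> + 1) ^ 3" using \<Delta> by (intro self_le_power) auto
  finally have step_bound: "norm s \<le> 6 * \<Delta> + 1"
    using \<Delta> by (simp add: power_mono_iff)
  have "norm (y' - y) \<le> norm s + norm (x - y)"
    using norm_triangle_ineq[of s "x - y"] by (simp add: y' algebra_simps)
  also have "\<dots> \<le> (1 - \<rho>) * D + \<rho> * D" using step_bound momentum D by linarith
  finally have y_change: "norm (y' - y) \<le> D" by (simp add: algebra_simps)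
  have \<beta>_le: "\<beta> \<le> \<rho>" "\<beta> \<le> norm (gradient d f y')" "\<beta> \<le> norm s" and \<beta>_nonneg: "0 \<le> \<beta>"
    using \<rho> by (auto simp: \<beta> y')
  have displacement: "norm (x' - y') \<le> D * b" if "\<beta> \<le> b" for b
  proof -
    have "norm (x' - y') \<le> \<beta> * norm (y' - y)"
      using x'_cases \<beta>_nonneg by (auto simp: v)
    also have "\<dots> \<le> b * D" using that \<beta>_nonneg y_change by (intro mult_mono) auto
    finally show ?thesis by (simp add: mult.commute)
  qed
  show "norm (x' - y') \<le> \<rho> * D" using displacement[OF \<beta>_le(1)] by (simp add: mult.commute)
  show "second_order_stationary d f \<epsilon> x' \<or> f x' \<le> f x - 7 * c ^ 3 / 48 * ?e ^ 3"
  proof (cases "norm s \<le> c * ?e")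
    case True
    have lip: "L\<^sub>1-lipschitz_on (Rd d) (gradient d f)" using assm_A by (simp add: assumption_A_def)
    have near: "norm (x' - (x + s)) \<le> D * norm (gradient d f (x + s))"
      "norm (x' - (x + s)) \<le> D * norm s"
      using displacement[OF \<beta>_le(2)] displacement[OF \<beta>_le(3)] by (simp_all add: y')
    note st = stationary_near_short_step[OF x'_in near lip D_nonneg less_imp_le[OF c(1)] c(2)
        less_imp_le[OF e(1)] c(3,4) True \<delta>(2)]
    have "norm (gradient d f x') \<le> \<epsilon>" using st(1) \<epsilon> by simp
    moreover have "- ?e \<le> lambda_min d (hessian d f x')"
      using symmetric_hessian[OF assm_A L2 x'_in] d st(2) by (rule lambda_min_ge)
    ultimately show ?thesis by (simp add: second_order_stationary_def)
  next
    case False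
    then have "(c * ?e) ^ 3 \<le> norm s ^ 3" using ce by (intro power_mono) auto
    then have "7 * c ^ 3 / 48 * ?e ^ 3 \<le> (norm s ^ 3 - \<delta> ^ 3) / 6"
      by (simp add: \<delta>_def power_mult_distrib power_divide)
    then show ?thesis using fx' decrease by linarith
  qed
qed

lemma nonstationary_run_decreases:
  assumes run: "inexact_CRm d f M \<rho> x\<^sub>0 H x" and x0: "x\<^sub>0 \<in> Rd d"
    and gap: "f x\<^sub>0 - (INF z\<in>Rd d. f z) = \<Delta>"
    and inexact: "\<And>k. mat_norm d (H k - hessian d f (x k)) \<le> c / 2 * sqrt \<epsilon>"
    and nonstationary: "\<And>j. j \<le> k \<Longrightarrow> \<not> second_order_stationary d f \<epsilon> (x j)"
  shows "x k \<in> Rd d" and "f (x k) \<le> f x\<^sub>0 - real k * (7 * c ^ 3 / 48 * sqrt \<epsilon> ^ 3)"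
proof -
  let ?\<eta> = "7 * c ^ 3 / 48 * sqrt \<epsilon> ^ 3"
  obtain y s v \<beta> where init: "x 0 = x\<^sub>0" "y 0 = x\<^sub>0" and
    step: "\<And>k. symmetric_matrix d (H k)"
      "\<And>k. is_arg_min (cubic_model d f M (H k) (x k)) (\<lambda>z. z \<in> Rd d) (s (Suc k))"
      "\<And>k. y (Suc k) = x k + s (Suc k)"
      "\<And>k. \<beta> (Suc k) = Min {\<rho>, norm (gradient d f (y (Suc k))), norm (y (Suc k) - x k)}"
      "\<And>k. v (Suc k) = y (Suc k) + \<beta> (Suc k) *\<^sub>R (y (Suc k) - y k)"
      "\<And>k. is_arg_min f (\<lambda>z. z \<in> {y (Suc k), v (Suc k)}) (x (Suc k))"
    using run unfolding inexact_CRm_def by blast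
  have base: "norm (x 0 - y 0) \<le> \<rho> * D" using init \<rho> D_nonneg by simp
  have "x j \<in> Rd d \<and> y j \<in> Rd d \<and> norm (x j - y j) \<le> \<rho> * D \<and> f (x j) \<le> f x\<^sub>0 - real j * ?\<eta>"
    if "j \<le> k" for j
    using that
  proof (induction j)
    case 0
    then show ?case using init x0 base by simp
  next
    case (Suc j)
    then have IH: "x j \<in> Rd d" "y j \<in> Rd d" "norm (x j - y j) \<le> \<rho> * D"
      "f (x j) \<le> f x\<^sub>0 - real j * ?\<eta>" by auto
    have "0 \<le> real j * ?\<eta>" using c \<epsilon> by simp
    then have "f (x j) - (INF z\<in>Rd d. f z) \<le> \<Delta>" using IH(4) gap by linarith
    note it = iteration[OF IH(1,2,3) this step(1) inexact step(2,3,4,5,6)]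
    have "f (x (Suc j)) \<le> f (x j) - ?\<eta>" using it(4) nonstationary[OF Suc.prems] by blast
    then have "f (x (Suc j)) \<le> f x\<^sub>0 - real (Suc j) * ?\<eta>"
      using IH(4) unfolding of_nat_Suc distrib_right by linarith
    then show ?case using it(1,2,3) by blast
  qed
  then show "x k \<in> Rd d" and "f (x k) \<le> f x\<^sub>0 - real k * ?\<eta>" by auto
qed

end

theorem theorem3:
  fixes L\<^sub>1 L\<^sub>2 M \<rho> \<Delta> :: real
  assumes "L\<^sub>1 > 0" and "L\<^sub>2 > 0"
    and "M > 2 * L\<^sub>2 / 3 + 2"
    and "0 \<le> \<rho>" and "\<rho> < 1"
    and "\<Delta> \<ge> 0"
  shows "\<exists>C>0. \<exists>\<theta>>0. \<forall>(d::nat) f x\<^sub>0 \<epsilon> H x.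
           d \<ge> 1 \<longrightarrow>
           assumption_A d f L\<^sub>1 L\<^sub>2 \<longrightarrow>
           x\<^sub>0 \<in> Rd d \<longrightarrow>
           f x\<^sub>0 - (INF z\<in>Rd d. f z) = \<Delta> \<longrightarrow>
           0 < \<epsilon> \<longrightarrow> \<epsilon> \<le> 1 \<longrightarrow>
           inexact_CRm d f M \<rho> x\<^sub>0 H x \<longrightarrow>
           (\<forall>k. mat_norm d (H k - hessian d f (x k)) \<le> \<theta> * sqrt \<epsilon>) \<longrightarrow>
           (\<forall>k::nat. real k \<ge> C / \<epsilon> powr (3/2) \<longrightarrow>
              (\<exists>j\<le>k. second_order_stationary d f \<epsilon> (x j)))"
proof -
  define D where "D = (6 * \<Delta> + 1) / (1 - \<rho>)"
  \<comment> \<open>The two factors that \<open>c\<close> has to compensate, for the gradient and for the Hessian;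
    \<open>Q \<ge> 1\<close> gives \<open>c \<le> 1\<close>.\<close>
  define P where "P = (1 + L\<^sub>1 * D) * ((L\<^sub>2 + M) / 2 + 1)"
  define Q where "Q = M / 2 + 1 + L\<^sub>2 * (1 + D)"
  define c where "c = 1 / (P + Q)"
  define \<eta> where "\<eta> = 7 * c ^ 3 / 48"
  have D: "(1 - \<rho>) * D = 6 * \<Delta> + 1" "0 \<le> D" using assms by (auto simp: D_def)
  have "0 < M" using assms by linarith
  then have "0 \<le> P" "1 \<le> Q"
    using assms D by (auto simp: P_def Q_def intro!: mult_nonneg_nonneg add_nonneg_nonneg)
  then have c: "0 < c" "c \<le> 1" "P * c \<le> 1" "Q * c \<le> 1"
    by (auto simp: c_def divide_le_eq)
  have "0 < \<eta>" using c by (simp add: \<eta>_def)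
  have main: "\<exists>j\<le>k. second_order_stationary d f \<epsilon> (x j)"
    if d: "d \<ge> 1" and A: "assumption_A d f L\<^sub>1 L\<^sub>2" and x0: "x\<^sub>0 \<in> Rd d"
      and gap: "f x\<^sub>0 - (INF z\<in>Rd d. f z) = \<Delta>" and \<epsilon>: "0 < \<epsilon>" "\<epsilon> \<le> 1"
      and run: "inexact_CRm d f M \<rho> x\<^sub>0 H x"
      and inexact: "\<forall>k. mat_norm d (H k - hessian d f (x k)) \<le> c / 2 * sqrt \<epsilon>"
      and k: "(\<Delta> + 1) / \<eta> / \<epsilon> powr (3/2) \<le> real k"
    for d f x\<^sub>0 \<epsilon> H x and k :: nat
  proof -
    interpret CRm_constants d f L\<^sub>1 L\<^sub>2 M \<rho> \<Delta> D c \<epsilon>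
      by standard (use d A assms D c \<epsilon> in \<open>auto simp: P_def Q_def\<close>)
    show ?thesis
    proof (rule ccontr)
      assume "\<not> ?thesis"
      then have nonst: "\<And>j. j \<le> k \<Longrightarrow> \<not> second_order_stationary d f \<epsilon> (x j)" by blast
      have dec: "x k \<in> Rd d" "f (x k) \<le> f x\<^sub>0 - real k * (\<eta> * sqrt \<epsilon> ^ 3)"
        using nonstationary_run_decreases[OF run x0 gap inexact[rule_format] nonst]
        unfolding \<eta>_def by blast+
      have "(INF z\<in>Rd d. f z) \<le> f (x k)"
        using A dec(1) by (intro cINF_lower) (auto simp: assumption_A_def)
      then have "real k * (\<eta> * sqrt \<epsilon> ^ 3) \<le> \<Delta>" using dec(2) gap by linarith
      moreover have "sqrt \<epsilon> ^ 3 = \<epsilon> powr (3/2)"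
        using \<epsilon> by (simp add: powr_half_sqrt[symmetric] powr_power)
      ultimately have "real k * (\<eta> * \<epsilon> powr (3/2)) \<le> \<Delta>" by simp
      moreover have "\<Delta> + 1 \<le> real k * (\<eta> * \<epsilon> powr (3/2))"
        using k \<open>0 < \<eta>\<close> \<epsilon> by (simp add: divide_le_eq mult_ac)
      ultimately show False by simp
    qed
  qed
  show ?thesis
  proof (rule exI[of _ "(\<Delta> + 1) / \<eta>"], rule conjI)
    show "0 < (\<Delta> + 1) / \<eta>" using \<open>0 < \<eta>\<close> assms by simp
  qed (rule exI[of _ "c / 2"], intro conjI allI impI, use c in simp, rule main)
qed

end
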